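(* If every prime element of $\mathcal{O}_K$ is $\mathcal{H}$-suitable, then $\mathcal{H}$ is a principal ideal domain (every left ideal $\mathcal{I}$ of $\mathcal{H}$ is of the form $\mathcal{H}D$ for some $D\in\mathcal{H}$).
   Context: Let $K$ be a totally real number field of degree $n$ over $\mathbb{Q}$ with real embeddings $\sigma_1,\dots,\sigma_n$ and ring of integers $\mathcal{O}_K$ a unique factorization domain; regard $K\subset\mathbb{R}$ via $\sigma_1$. $N_{K/\mathbb{Q}}(\lambda)=\sigma_1(\lambda)\cdots\sigma_n(\lambda)$; $\lambda$ is totally positive if all $\sigma_t(\lambda)>0$. Let $i,j,k$ be the real quaternion units with $i^2=j^2=k^2=ijk=-1$; for $L=x+yi+zj+wk$ put $\overline{L}=x-yi-zj-wk$ and $N(L)=L\overline{L}$. Fix $A,B,\mu,\nu\in\mathcal{O}_K$ such that $S=4A-\mu^2$ and $T=BS-\nu^2$ are totally positive; put $\alpha=\frac{\mu+i\sqrt{S}}{2}$, $\beta=\frac{\nu i+j\sqrt{T}}{\sqrt{S}}$, and $\mathcal{H}=\{x+y\alpha+z\beta+w\alpha\beta : x,y,z,w\in\mathcal{O}_K\}$ (a ring; norms of its elements lie in $\mathcal{O}_K$). The double norm is $\mathcal{N}=N_{K/\mathbb{Q}}\circ N$. For $L\in\mathcal{H}$, "$\rho\mid L$" means $L\in\rho\mathcal{H}$. A prime element $\rho\in\mathcal{O}_K$ is $\mathcal{H}$-suitable if for every $L\in\mathcal{H}$ with $\rho\nmid L$, the set $\mathcal{H}\frac{L}{\rho}+\mathcal{H}$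 contains a nonzero element $L'$ with $\mathcal{N}(L')<1$. *)

theory Defs
  imports Complex_Main "HOL-Library.FuncSet" "HOL-Algebra.Algebraic_Closure_Type"
begin

datatype quat = Quat (qRe: real) (qI: real) (qJ: real) (qK: real)

lemma quat_eq_iff: "x = y \<longleftrightarrow> qRe x = qRe y \<and> qI x = qI y \<and> qJ x = qJ y \<and> qK x = qK y"
  by (cases x; cases y) simp

instantiation quat :: real_algebra_1
begin

definition "0 = Quat 0 0 0 0"
definition "1 = Quat 1 0 0 0"
definition "x + y = Quat (qRe x + qRe y) (qI x + qI y) (qJ x + qJ y) (qK x + qK y)"
definition "- x = Quat (- qRe x) (- qI x) (- qJ x) (- qK x)"
definition "x - y = Quat (qRe x - qRe y) (qI x - qI y) (qJ x - qJ y) (qK x - qK y)"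
definition "r *\<^sub>R x = Quat (r * qRe x) (r * qI x) (r * qJ x) (r * qK x)"
definition "x * y = Quat
  (qRe x * qRe y - qI x * qI y - qJ x * qJ y - qK x * qK y)
  (qRe x * qI y + qI x * qRe y + qJ x * qK y - qK x * qJ y)
  (qRe x * qJ y - qI x * qK y + qJ x * qRe y + qK x * qI y)
  (qRe x * qK y + qI x * qJ y - qJ x * qI y + qK x * qRe y)"

instance
  by standard
    (auto simp: zero_quat_def one_quat_def plus_quat_def uminus_quat_def minus_quat_def
       scaleR_quat_def times_quat_def algebra_simps)

end

definition quat_i :: quat where "quat_i = Quat 0 1 0 0"
definition quat_j :: quat where "quat_j = Quat 0 0 1 0"
definition quat_k :: quat where "quat_k = Quat 0 0 0 1"

lemma quat_unit_relations:
  "quat_i * quat_i = - 1" "quat_j * quat_j = - 1" "quat_k * quat_k = - 1"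
  "quat_i * quat_j * quat_k = - 1"
  by (simp_all add: quat_i_def quat_j_def quat_k_def times_quat_def uminus_quat_def one_quat_def)

lemma Quat_expand:
  "Quat x y z w = of_real x + y *\<^sub>R quat_i + z *\<^sub>R quat_j + w *\<^sub>R quat_k"
  by (simp add: of_real_def quat_i_def quat_j_def quat_k_def plus_quat_def scaleR_quat_def
      one_quat_def)

definition qcnj :: "quat \<Rightarrow> quat" where
  "qcnj L = Quat (qRe L) (- qI L) (- qJ L) (- qK L)"

definition qnorm :: "quat \<Rightarrow> real" where
  "qnorm L = qRe (L * qcnj L)"

lemma of_real_qnorm: "of_real (qnorm L) = L * qcnj L"
  by (simp add: qnorm_def qcnj_def of_real_def times_quat_def scaleR_quat_def one_quat_def)

abbreviation subring_of :: "'a::ring_1 set \<Rightarrow> 'a ring" where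
  "subring_of S \<equiv> ring_of_type_algebra\<lparr>carrier := S\<rparr>"

definition number_field :: "nat \<Rightarrow> real set \<Rightarrow> bool" where
  "number_field n K \<longleftrightarrow> subfield K ring_of_type_algebra \<and>
     ring.dimension ring_of_type_algebra n \<rat> K"

definition totally_real :: "real set \<Rightarrow> bool" where
  "totally_real K \<longleftrightarrow>
     (\<forall>\<phi> \<in> ring_hom (subring_of K) (ring_of_type_algebra :: complex ring). \<phi> ` K \<subseteq> \<real>)"

text \<open>Embeddings are taken in \<^const>\<open>extensional\<close>, so that different functions in this set
  are different embeddings of \<open>K\<close>.\<close>

definition real_embeddings :: "real set \<Rightarrow> (real \<Rightarrow> real) set" where
  "real_embeddings K =
     ring_hom (subring_of K) (ring_of_type_algebra :: real ring) \<inter> extensional K"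

definition ring_of_integers :: "real set \<Rightarrow> real set" where
  "ring_of_integers K = {x \<in> K. algebraic_int x}"

definition field_norm :: "nat \<Rightarrow> (nat \<Rightarrow> real \<Rightarrow> real) \<Rightarrow> real \<Rightarrow> real" where
  "field_norm n \<sigma> x = (\<Prod>t=1..n. \<sigma> t x)"

definition totally_positive :: "nat \<Rightarrow> (nat \<Rightarrow> real \<Rightarrow> real) \<Rightarrow> real \<Rightarrow> bool" where
  "totally_positive n \<sigma> x \<longleftrightarrow> (\<forall>t\<in>{1..n}. \<sigma> t x > 0)"

definition disc_S :: "real \<Rightarrow> real \<Rightarrow> real" where
  "disc_S A \<mu> = 4 * A - \<mu>\<^sup>2"

definition disc_T :: "real \<Rightarrow> real \<Rightarrow> real \<Rightarrow> real \<Rightarrow> real" where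
  "disc_T A B \<mu> \<nu> = B * disc_S A \<mu> - \<nu>\<^sup>2"

definition quat_alpha :: "real \<Rightarrow> real \<Rightarrow> quat" where
  "quat_alpha A \<mu> = (of_real \<mu> + sqrt (disc_S A \<mu>) *\<^sub>R quat_i) /\<^sub>R 2"

definition quat_beta :: "real \<Rightarrow> real \<Rightarrow> real \<Rightarrow> real \<Rightarrow> quat" where
  "quat_beta A B \<mu> \<nu> =
     (\<nu> *\<^sub>R quat_i + sqrt (disc_T A B \<mu> \<nu>) *\<^sub>R quat_j) /\<^sub>R sqrt (disc_S A \<mu>)"

definition quat_order :: "real set \<Rightarrow> real \<Rightarrow> real \<Rightarrow> real \<Rightarrow> real \<Rightarrow> quat set" where
  "quat_order K A B \<mu> \<nu> =
     {of_real x + y *\<^sub>R quat_alpha A \<mu> + z *\<^sub>R quat_beta A B \<mu> \<nu>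
        + w *\<^sub>R (quat_alpha A \<mu> * quat_beta A B \<mu> \<nu>) | x y z w.
      x \<in> ring_of_integers K \<and> y \<in> ring_of_integers K \<and>
      z \<in> ring_of_integers K \<and> w \<in> ring_of_integers K}"

definition double_norm :: "nat \<Rightarrow> (nat \<Rightarrow> real \<Rightarrow> real) \<Rightarrow> quat \<Rightarrow> real" where
  "double_norm n \<sigma> L = field_norm n \<sigma> (qnorm L)"

definition suitable :: "nat \<Rightarrow> (nat \<Rightarrow> real \<Rightarrow> real) \<Rightarrow> quat set \<Rightarrow> real \<Rightarrow> bool" where
  "suitable n \<sigma> H \<rho> \<longleftrightarrow>
     (\<forall>L\<in>H. L \<notin> {\<rho> *\<^sub>R M | M. M \<in> H} \<longrightarrow>
        (\<exists>L' \<in> {P * (L /\<^sub>R \<rho>) + Q | P Q. P \<in> H \<and> Q \<in> H}.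
           L' \<noteq> 0 \<and> double_norm n \<sigma> L' < 1))"

definition left_ideal :: "'a set \<Rightarrow> 'a ring \<Rightarrow> bool" where
  "left_ideal I R \<longleftrightarrow> additive_subgroup I R \<and>
     (\<forall>a\<in>carrier R. \<forall>x\<in>I. a \<otimes>\<^bsub>R\<^esub> x \<in> I)"

text \<open>The library's \<^const>\<open>domain\<close> and \<^const>\<open>principal_domain\<close> are commutative.
  \<^const>\<open>cgenideal\<close> is the left ideal of left multiples of its generator.\<close>

definition left_principal_ideal_domain :: "'a ring \<Rightarrow> bool" where
  "left_principal_ideal_domain R \<longleftrightarrow>
     ring R \<and> \<one>\<^bsub>R\<^esub> \<noteq> \<zero>\<^bsub>R\<^esub> \<and>
     (\<forall>a\<in>carrier R. \<forall>b\<in>carrier R. a \<otimes>\<^bsub>R\<^esub> b = \<zero>\<^bsub>R\<^esub> \<longrightarrow> a = \<zero>\<^bsub>R\<^esub> \<or> b = \<zero>\<^bsub>R\<^esub>) \<and>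
     (\<forall>I. left_ideal I R \<longrightarrow> (\<exists>D\<in>carrier R. I = PIdl\<^bsub>R\<^esub> D))"

end

theory Submission
  imports Defs "Jordan_Normal_Form.Determinant"
begin

text \<open>Let \<open>D\<close> be a nonzero element of least double norm in a left ideal \<open>I\<close>, let \<open>M \<in> I\<close> and
  \<open>Y = M D\<^sup>-\<^sup>1\<close>. The norm of \<open>D\<close> is a denominator of \<open>Y\<close>; if \<open>Y \<notin> \<H>\<close>, stripping prime factors off
  this denominator gives a prime \<open>\<rho>\<close> and an integer \<open>d\<close> with \<open>\<rho> d Y \<in> \<H>\<close> but \<open>d Y \<notin> \<H>\<close>. Suitability of \<open>\<rho>\<close>
  yields \<open>P d Y + Q \<noteq> 0\<close> of double norm less than 1, and then \<open>(P d Y + Q) D \<in> I\<close> contradicts the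
  choice of \<open>D\<close>.

  A least double norm exists because field norms of algebraic integers are integers. The product
  of the conjugates of \<open>x\<close> is the determinant of multiplication by \<open>x\<close> over \<open>\<rat>\<close>, since the matrix of
  conjugates of a basis is invertible by Dedekind's independence of characters. As all powers of
  \<open>x\<close> lie in a finitely generated \<open>\<int>\<close>-module, the powers of the norm have a common denominator,
  which forces the norm to be an integer.\<close>

section \<open>Independence of characters\<close>

text \<open>Evaluating the relation at \<open>m y x\<close> and subtracting \<open>g y\<close> times
  the relation at \<open>x\<close> eliminates \<open>g\<close> and leaves a shorter relation with
  coefficients \<open>c f * (f y - g y)\<close>. Induction kills these, and \<open>y\<close> is
  chosen where a given \<open>h\<close> differs from \<open>g\<close>.\<close>

lemma Dedekind_independence:
  fixes F :: "('a \<Rightarrow> 'b::field) set" and c :: "('a \<Rightarrow> 'b) \<Rightarrow> 'b" and m :: "'a \<Rightarrow> 'a \<Rightarrow> 'a"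
  assumes "finite F"
    and closed: "\<And>x y. x \<in> K \<Longrightarrow> y \<in> K \<Longrightarrow> m x y \<in> K" and e: "e \<in> K"
    and mult: "\<And>f x y. f \<in> F \<Longrightarrow> x \<in> K \<Longrightarrow> y \<in> K \<Longrightarrow> f (m x y) = f x * f y"
    and one: "\<And>f. f \<in> F \<Longrightarrow> f e = 1"
    and dist: "\<And>f g. f \<in> F \<Longrightarrow> g \<in> F \<Longrightarrow> f \<noteq> g \<Longrightarrow> \<exists>x\<in>K. f x \<noteq> g x"
    and "\<And>x. x \<in> K \<Longrightarrow> (\<Sum>f\<in>F. c f * f x) = 0"
    and "f \<in> F"
  shows "c f = 0"
  using \<open>finite F\<close> mult one dist assms(7,8)
proof (induction F arbitrary: c f rule: finite_induct)
  case (insert g F)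
  have c0: "c h = 0" if h: "h \<in> F" for h
  proof -
    have hg: "h \<noteq> g"
      using h insert.hyps by blast
    obtain y where y: "y \<in> K" "h y \<noteq> g y"
      using insert.prems(3)[of h g] h hg by auto
    have "c h * (h y - g y) = 0"
    proof (rule insert.IH[where c = "\<lambda>f. c f * (f y - g y)"])
      fix x assume x: "x \<in> K"
      have m: "f (m y x) = f y * f x" if "f \<in> insert g F" for f
        using insert.prems(1) that x y by blast
      have "(\<Sum>f\<in>F. c f * f (m y x)) = (\<Sum>f\<in>F. c f * (f y * f x))"
        by (rule sum.cong) (simp_all add: m)
      then have "(\<Sum>f\<in>F. c f * (f y - g y) * f x)
          = (\<Sum>f\<in>insert g F. c f * f (m y x)) - g y * (\<Sum>f\<in>insert g F. c f * f x)"
        using insert.hyps m[of g]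
        by (simp add: sum_distrib_left algebra_simps sum_subtractf)
      then show "(\<Sum>f\<in>F. c f * (f y - g y) * f x) = 0"
        using insert.prems(4) closed x y by simp
    qed (use insert.prems h in auto)
    then show ?thesis
      using y by simp
  qed
  \<comment> \<open>With all other coefficients zero, the relation at the unit isolates
    \<open>c g\<close>, because \<open>g e = 1\<close>.\<close>
  have "c g = (\<Sum>f\<in>insert g F. c f * f e)"
    using insert.hyps insert.prems(2) c0 by simp
  then have "c g = 0"
    using insert.prems(4)[OF e] by simp
  then show ?case
    using c0 insert.prems(5) by auto
qed simp

section \<open>Integrality through bounded denominators\<close>

lemma common_denominator:
  fixes S :: "'a::field_char_0 set"
  assumes "finite S" "S \<subseteq> \<rat>"
  shows "\<exists>D::int. D \<noteq> 0 \<and> (\<forall>r\<in>S. of_int D * r \<in> \<int>)"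
  using assms
proof (induction S rule: finite_induct)
  case empty
  show ?case by (intro exI[of _ 1]) simp
next
  case (insert r S)
  then obtain D :: int where D: "D \<noteq> 0" "\<forall>s\<in>S. of_int D * s \<in> \<int>"
    by auto
  obtain a b :: int where ab: "b > 0" "r = of_int a / of_int b"
    using insert.prems by (auto elim: Rats_cases')
  have "of_int (b * D) * r = of_int (D * a)"
    using ab by simp
  moreover have "of_int (b * D) * s \<in> \<int>" if "s \<in> S" for s
    using Ints_mult[OF Ints_of_int[of b] bspec[OF D(2) that]] by (simp add: mult.assoc)
  ultimately show ?case
    using D(1) ab(1) by (intro exI[of _ "b * D"]) (auto simp del: of_int_mult)
qed

text \<open>If \<open>q = a / b\<close> in lowest terms, then \<open>b ^ k\<close> divides
  \<open>c\<close> for every \<open>k\<close>, which a nonzero \<open>c\<close> permits only for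
  \<open>b = 1\<close>.\<close>

lemma Ints_if_bounded_denominator:
  fixes q :: "'a::field_char_0" and c :: int
  assumes c: "c \<noteq> 0" and pow: "\<And>k::nat. of_int c * q ^ k \<in> \<int>"
  shows "q \<in> \<int>"
proof -
  obtain m where m: "of_int c * q = of_int m"
    using pow[of 1] by (auto elim: Ints_cases)
  then have "q = of_int m / of_int c"
    using c by (simp add: field_simps)
  then have "q \<in> \<rat>" by simp
  then obtain a b :: int where ab: "b > 0" "coprime a b" "q = of_int a / of_int b"
    by (auto elim: Rats_cases')
  have dvd: "b ^ k dvd c" for k
  proof -
    obtain r where "of_int c * q ^ k = of_int r"
      using pow[of k] by (auto elim: Ints_cases)
    then have "(of_int (c * a ^ k) :: 'a) = of_int (r * b ^ k)"
      using ab by (simp add: field_simps)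
    then have "c * a ^ k = r * b ^ k"
      by (simp only: of_int_eq_iff)
    then have "b ^ k dvd c * a ^ k" by simp
    then show ?thesis
      using ab(2) by (metis coprime_commute coprime_dvd_mult_left_iff coprime_power_left_iff coprime_power_right_iff)
  qed
  have "b = 1"
  proof (rule ccontr)
    assume "b \<noteq> 1"
    then have "b \<ge> 2" using ab by simp
    \<comment> \<open>This exponent is large enough: \<open>b ^ k \<ge> 2 ^ k > k\<close>, while
      divisibility forces \<open>b ^ k \<le> k\<close>.\<close>
    define k where "k = nat \<bar>c\<bar>"
    have "int k < 2 ^ k"
      by (metis of_nat_less_two_power)
    also have "\<dots> \<le> b ^ k"
      using \<open>b \<ge> 2\<close> by (simp add: power_mono)
    also have "b ^ k \<le> \<bar>c\<bar>"
      using dvd_imp_le_int[OF c dvd[of k]] ab(1) by simp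
    finally show False by (simp add: k_def)
  qed
  then show ?thesis using ab(3) by simp
qed

text \<open>A monic integer polynomial rewrites its leading power by lower ones, so its degree
  serves as one \<open>d\<close> for all powers.\<close>

lemma algebraic_int_power_span:
  fixes x :: "'a::field_char_0"
  assumes "algebraic_int x"
  shows "\<exists>d::nat. \<forall>k. \<exists>c::nat \<Rightarrow> int. x ^ k = (\<Sum>j<d. of_int (c j) * x ^ j)"
proof -
  obtain p :: "int poly" where p: "poly (map_poly of_int p) x = 0" "lead_coeff p = 1"
    using assms by (auto simp: algebraic_int_altdef_ipoly)
  obtain m where m: "degree p = Suc m"
  proof (cases "degree p")
    case 0
    \<comment> \<open>A monic constant is 1 and has no root, so the degree is a successor.\<close>
    then have "p = 1" using p(2) by (metis degree_0_id of_int_hom.hom_one one_pCons)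
    then show ?thesis using p(1) by simp
  qed
  define e where "e j = - coeff p j" for j
  have "(\<Sum>j\<le>Suc m. of_int (coeff p j) * x ^ j) = 0"
    using p(1) m by (simp add: poly_altdef degree_map_poly coeff_map_poly)
  then have red: "x ^ Suc m = (\<Sum>j<Suc m. of_int (e j) * x ^ j)"
    using p(2) m
    by (simp add: e_def sum_negf lessThan_Suc_atMost eq_neg_iff_add_eq_0 algebra_simps)
  have "\<exists>c::nat \<Rightarrow> int. x ^ k = (\<Sum>j<Suc m. of_int (c j) * x ^ j)" for k
  proof (induction k)
    case 0
    show ?case
      by (intro exI[of _ "\<lambda>j. if j = 0 then 1 else 0"]) (simp add: sum.lessThan_Suc_shift del: sum.lessThan_Suc)
  next
    case (Suc k)
    then obtain c :: "nat \<Rightarrow> int" where c: "x ^ k = (\<Sum>j<Suc m. of_int (c j) * x ^ j)" by auto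
    \<comment> \<open>Multiplication by \<open>x\<close> shifts the coefficients up by one, with 0
      entering at the bottom; the overflowing term \<open>c m * x ^ Suc m\<close> is folded back by
      \<open>red\<close>.\<close>
    define c' where "c' j = (if j = 0 then 0 else c (j - 1)) + c m * e j" for j
    have "(\<Sum>j<Suc m. of_int (c' j) * x ^ j)
        = (\<Sum>j<Suc m. of_int (if j = 0 then 0 else c (j - 1)) * x ^ j)
          + of_int (c m) * (\<Sum>j<Suc m. of_int (e j) * x ^ j)"
      by (simp only: c'_def sum_distrib_left sum.distrib[symmetric] of_int_add of_int_mult
          distrib_right mult.assoc)
    also have "(\<Sum>j<Suc m. of_int (if j = 0 then 0 else c (j - 1)) * x ^ j)
        = (\<Sum>j<m. of_int (c j) * x ^ Suc j)"
      by (subst sum.lessThan_Suc_shift) simp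
    also have "\<dots> + of_int (c m) * (\<Sum>j<Suc m. of_int (e j) * x ^ j)
        = x * (\<Sum>j<Suc m. of_int (c j) * x ^ j)"
      by (simp only: red[symmetric]) (simp add: sum_distrib_left algebra_simps)
    finally show ?case
      using c by (intro exI[of _ c']) simp
  qed
  then show ?thesis by blast
qed

lemma Ints_det:
  assumes "A \<in> carrier_mat n n" "\<And>i j. i < n \<Longrightarrow> j < n \<Longrightarrow> A $$ (i, j) \<in> \<int>"
  shows "Determinant.det A \<in> \<int>"
  unfolding det_def'[OF assms(1)]
  by (intro Ints_sum Ints_mult Ints_prod assms(2)) (auto dest: permutes_in_image)

section \<open>Subsets of a type as rings\<close>

lemma subfield_Rats: "subfield \<rat> (ring_of_type_algebra :: 'a::field_char_0 ring)"
proof -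
  interpret field "ring_of_type_algebra :: 'a ring" ..
  have neg: "\<ominus>\<^bsub>ring_of_type_algebra\<^esub> x = - x" for x :: 'a
    by (rule minus_equality) (simp_all add: ring_of_type_algebra_def)
  have sr: "subring \<rat> (ring_of_type_algebra :: 'a ring)"
    by (rule subringI) (unfold neg, auto simp: ring_of_type_algebra_def)
  have "Units ((ring_of_type_algebra :: 'a ring)\<lparr>carrier := \<rat>\<rparr>) = \<rat> - {0}"
    by (auto simp: Units_def ring_of_type_algebra_def intro!: bexI[of _ "inverse _"])
  then show ?thesis
    using subfieldI[OF subcringI'[OF sr]] by (simp add: ring_of_type_algebra_def)
qed

lemma ring_of_type_algebra_simps [simp]:
  "carrier ring_of_type_algebra = UNIV"
  "x \<otimes>\<^bsub>ring_of_type_algebra\<^esub> y = x * y" "x \<oplus>\<^bsub>ring_of_type_algebra\<^esub> y = x + y"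
  "\<one>\<^bsub>ring_of_type_algebra\<^esub> = 1" "\<zero>\<^bsub>ring_of_type_algebra\<^esub> = 0"
  by (simp_all add: ring_of_type_algebra_def)

lemma a_inv_subring_of:
  assumes "ring (subring_of S)" "x \<in> S"
  shows "\<ominus>\<^bsub>subring_of S\<^esub> x = - x"
  using abelian_group.r_neg[OF ring.is_abelian_group[OF assms(1)], of x] assms(2)
  by (simp add: add_eq_0_iff)

lemma uminus_mem_subring_of:
  assumes "ring (subring_of S)" "x \<in> S"
  shows "- x \<in> S"
  using abelian_group.a_inv_closed[OF ring.is_abelian_group[OF assms(1)], of x] assms
  by (simp add: a_inv_subring_of)

lemma ring_subring_ofI:
  fixes S :: "'a::ring_1 set"
  assumes "0 \<in> S" "1 \<in> S" "\<And>x. x \<in> S \<Longrightarrow> - x \<in> S"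
    and "\<And>x y. x \<in> S \<Longrightarrow> y \<in> S \<Longrightarrow> x + y \<in> S"
    and "\<And>x y. x \<in> S \<Longrightarrow> y \<in> S \<Longrightarrow> x * y \<in> S"
  shows "ring (subring_of S)"
proof (rule ringI)
  show "abelian_group (subring_of S)"
    by (rule abelian_groupI) (use assms in \<open>auto simp: intro!: bexI[of _ "- _"]\<close>)
  show "Group.monoid (subring_of S)"
    by (rule monoidI) (use assms in \<open>auto simp: mult.assoc\<close>)
qed (auto simp: algebra_simps)

section \<open>Arithmetic of the field and its real embeddings\<close>

text \<open>The bijection provides as many real embeddings as the degree, so the norm built from
  \<sigma> runs over a full set of conjugates.\<close>

locale number_field_embeddings =
  fixes K :: "real set" and n :: nat and \<sigma> :: "nat \<Rightarrow> real \<Rightarrow> real"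
  assumes nf: "number_field n K" and bij: "bij_betw \<sigma> {1..n} (real_embeddings K)"
begin

lemma sub: "subfield K ring_of_type_algebra"
  using nf by (simp add: number_field_def)

lemma K_closed:
  "0 \<in> K" "1 \<in> K" "x \<in> K \<Longrightarrow> y \<in> K \<Longrightarrow> x + y \<in> K" "x \<in> K \<Longrightarrow> y \<in> K \<Longrightarrow> x * y \<in> K"
  "x \<in> K \<Longrightarrow> - x \<in> K"
proof -
  interpret field "ring_of_type_algebra :: real ring" ..
  have neg: "\<ominus>\<^bsub>ring_of_type_algebra\<^esub> x = - x" for x :: real
    by (rule minus_equality) (simp_all add: ring_of_type_algebra_def)
  show "0 \<in> K" "1 \<in> K" "x \<in> K \<Longrightarrow> y \<in> K \<Longrightarrow> x + y \<in> K"
    "x \<in> K \<Longrightarrow> y \<in> K \<Longrightarrow> x * y \<in> K" "x \<in> K \<Longrightarrow> - x \<in> K"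
    using subringE(2,3)[OF subfieldE(1)[OF sub]] subringE(5-7)[OF subfieldE(1)[OF sub]]
    by (auto simp: neg)
qed

lemma K_diff: "x \<in> K \<Longrightarrow> y \<in> K \<Longrightarrow> x - y \<in> K"
  using K_closed(3)[of x "- y"] K_closed(5) by simp

lemma K_inverse: assumes "x \<in> K" shows "inverse x \<in> K"
proof (cases "x = 0")
  case False
  have "Units (subring_of K) = K - {0}"
    using subfield.subfield_Units[OF sub] by (simp add: ring_of_type_algebra_def)
  then have "x \<in> Units (subring_of K)" using False assms by blast
  then obtain y where "y \<in> K" "x * y = 1"
    by (auto simp: Units_def)
  then show ?thesis by (metis inverse_unique)
qed (use K_closed in simp)

lemma K_sum: "(\<And>i. i \<in> S \<Longrightarrow> f i \<in> K) \<Longrightarrow> sum f S \<in> K"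
  by (induction S rule: infinite_finite_induct) (auto intro: K_closed)

lemma K_power: "x \<in> K \<Longrightarrow> x ^ k \<in> K"
  by (induction k) (auto intro: K_closed)

lemma K_Ints: assumes "x \<in> \<int>" shows "x \<in> K"
proof -
  have nat: "of_nat k \<in> K" for k
    by (induction k) (auto intro: K_closed)
  obtain m :: int where "x = of_int m" using assms by (auto elim: Ints_cases)
  then show ?thesis
    using nat K_closed(5) by (cases m rule: int_cases2) auto
qed

lemma K_Rats: assumes "x \<in> \<rat>" shows "x \<in> K"
proof -
  obtain a b :: int where "x = of_int a * inverse (of_int b)"
    using assms by (auto elim: Rats_cases' simp: divide_inverse)
  then show ?thesis
    using K_closed(4) K_inverse K_Ints by simp
qed

text \<open>The family has exactly \<open>n\<close> members, which makes the matrix of conjugates in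
  \<open>field_norm_eq_det\<close> square.\<close>

lemma spanning_family:
  obtains b :: "nat \<Rightarrow> real" where "\<And>i. i < n \<Longrightarrow> b i \<in> K"
    and "\<And>x. x \<in> K \<Longrightarrow> \<exists>r. (\<forall>i<n. r i \<in> \<rat>) \<and> x = (\<Sum>i<n. r i * b i)"
proof -
  interpret field "ring_of_type_algebra :: real ring" ..
  obtain Vs where Vs: "length Vs = n" "Span \<rat> Vs = K"
    using exists_base[OF subfield_Rats] nf unfolding number_field_def by blast
  have carr: "set Vs \<subseteq> carrier ring_of_type_algebra"
    by (simp add: ring_of_type_algebra_def)
  have comb: "combine Ks Us = (\<Sum>i<length Us. Ks ! i * Us ! i)" if "length Ks = length Us" for Ks Us
    using that
    by (induction Ks Us rule: list_induct2)
       (simp_all add: sum.lessThan_Suc_shift del: sum.lessThan_Suc)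
  show thesis
  proof
    show "Vs ! i \<in> K" if "i < n" for i
      using Span_base_incl[OF subfield_Rats carr] that Vs by auto
    show "\<exists>r. (\<forall>i<n. r i \<in> \<rat>) \<and> x = (\<Sum>i<n. r i * Vs ! i)" if "x \<in> K" for x
    proof -
      have "x \<in> Span \<rat> Vs"
        unfolding Vs(2) by (rule that)
      then obtain Ks where Ks: "set Ks \<subseteq> \<rat>" "length Ks = length Vs" "x = combine Ks Vs"
        unfolding Span_mem_iff_length_version[OF subfield_Rats carr] by (elim exE conjE)
      then show ?thesis
        using comb[OF Ks(2)] Vs(1) by (intro exI[of _ "(!) Ks"]) auto
    qed
  qed
qed

context
  fixes t assumes t: "t \<in> {1..n}"
begin

lemma \<sigma>_hom: "\<sigma> t \<in> Ring.ring_hom (subring_of K) (ring_of_type_algebra :: real ring)"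
  using bij_betwE[OF bij] t by (auto simp: real_embeddings_def)

lemma \<sigma>_one: "\<sigma> t 1 = 1"
  using ring_hom_one[OF \<sigma>_hom] by simp

lemma \<sigma>_mult: "x \<in> K \<Longrightarrow> y \<in> K \<Longrightarrow> \<sigma> t (x * y) = \<sigma> t x * \<sigma> t y"
  using ring_hom_mult[OF \<sigma>_hom, of x y] by simp

lemma \<sigma>_add: "x \<in> K \<Longrightarrow> y \<in> K \<Longrightarrow> \<sigma> t (x + y) = \<sigma> t x + \<sigma> t y"
  using ring_hom_add[OF \<sigma>_hom, of x y] by simp

lemma \<sigma>_zero: "\<sigma> t 0 = 0"
  using \<sigma>_add[of 0 0] K_closed by simp

lemma \<sigma>_uminus: "x \<in> K \<Longrightarrow> \<sigma> t (- x) = - \<sigma> t x"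
  using \<sigma>_add[of x "- x"] K_closed \<sigma>_zero by simp

lemma \<sigma>_diff: "x \<in> K \<Longrightarrow> y \<in> K \<Longrightarrow> \<sigma> t (x - y) = \<sigma> t x - \<sigma> t y"
  using \<sigma>_add[of x "- y"] K_closed \<sigma>_uminus by simp

lemma \<sigma>_sum: "(\<And>i. i \<in> S \<Longrightarrow> f i \<in> K) \<Longrightarrow> \<sigma> t (sum f S) = (\<Sum>i\<in>S. \<sigma> t (f i))"
  by (induction S rule: infinite_finite_induct) (auto simp: \<sigma>_zero \<sigma>_add K_sum)

lemma \<sigma>_power: "x \<in> K \<Longrightarrow> \<sigma> t (x ^ k) = \<sigma> t x ^ k"
  by (induction k) (auto simp: \<sigma>_one \<sigma>_mult K_power)

lemma \<sigma>_eq_0_iff: assumes "x \<in> K" shows "\<sigma> t x = 0 \<longleftrightarrow> x = 0"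
  using \<sigma>_mult[OF assms K_inverse[OF assms]] \<sigma>_one \<sigma>_zero by (cases "x = 0") auto

lemma \<sigma>_of_nat: "\<sigma> t (of_nat k) = of_nat k"
  by (induction k) (auto simp: \<sigma>_zero \<sigma>_one \<sigma>_add K_closed K_Ints)

lemma \<sigma>_of_int: "\<sigma> t (of_int m) = of_int m"
  by (cases m rule: int_cases2) (auto simp: \<sigma>_of_nat \<sigma>_uminus K_Ints)

lemma \<sigma>_Rats: assumes "x \<in> \<rat>" shows "\<sigma> t x = x"
proof -
  obtain a b :: int where ab: "b > 0" "x = of_int a / of_int b"
    using assms by (auto elim: Rats_cases')
  have "\<sigma> t x * of_int b = \<sigma> t (x * of_int b)"
    using assms by (simp add: \<sigma>_mult K_Rats K_Ints \<sigma>_of_int)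
  also have "\<dots> = of_int a"
    using ab by (simp add: \<sigma>_of_int)
  also have "\<dots> = x * of_int b"
    using ab by simp
  finally show ?thesis using ab(1) by simp
qed

end

lemma \<sigma>_independent:
  assumes "\<And>x. x \<in> K \<Longrightarrow> (\<Sum>t=1..n. c t * \<sigma> t x) = 0" and "t \<in> {1..n}"
  shows "c t = 0"
proof -
  \<comment> \<open>Dedekind's lemma attaches coefficients to functions, so \<open>s\<close>
    recovers the index of an embedding.\<close>
  define s where "s = inv_into {1..n} \<sigma>"
  have s: "s (\<sigma> t) = t" if "t \<in> {1..n}" for t
    using bij_betw_inv_into_left[OF bij that] by (simp add: s_def)
  have "(c \<circ> s) (\<sigma> t) = 0"
  proof (rule Dedekind_independence[where F = "\<sigma> ` {1..n}" and m = "(*)" and e = 1 and K = K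
        and c = "c \<circ> s" and f = "\<sigma> t"])
    fix f g assume fg: "f \<in> \<sigma> ` {1..n}" "g \<in> \<sigma> ` {1..n}" "f \<noteq> g"
    \<comment> \<open>Extensional functions agree outside \<open>K\<close>, so distinct ones must
      differ at a point of \<open>K\<close>.\<close>
    then have "f \<in> extensional K" "g \<in> extensional K"
      using bij_betw_imp_surj_on[OF bij] by (auto simp: real_embeddings_def)
    then show "\<exists>x\<in>K. f x \<noteq> g x"
      using fg(3) extensionalityI by blast
  next
    fix x assume "x \<in> K"
    then show "(\<Sum>f\<in>\<sigma> ` {1..n}. (c \<circ> s) f * f x) = 0"
      using assms(1) s by (subst sum.reindex[OF bij_betw_imp_inj_on[OF bij]]) simp
  qed (use assms(2) K_closed \<sigma>_mult \<sigma>_one in auto)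
  then show ?thesis using s[OF assms(2)] by simp
qed

section \<open>The field norm as a determinant, and its integrality\<close>

text \<open>Applying every embedding to \<open>yb\<close> gives \<open>P * E = E * Y\<close> with
  \<open>Y\<close> the diagonal matrix of conjugates of \<open>y\<close>; an invertible
  \<open>E\<close> cancels from the determinants.\<close>

lemma field_norm_eq_det:
  assumes b: "\<And>i. i < n \<Longrightarrow> b i \<in> K"
    and span: "\<And>x. x \<in> K \<Longrightarrow> \<exists>r. (\<forall>i<n. r i \<in> \<rat>) \<and> x = (\<Sum>i<n. r i * b i)"
    and y: "y \<in> K"
    and M: "\<And>i j. i < n \<Longrightarrow> j < n \<Longrightarrow> M i j \<in> \<rat>"
    and yb: "\<And>i. i < n \<Longrightarrow> y * b i = (\<Sum>j<n. M i j * b j)"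
  shows "field_norm n \<sigma> y = Determinant.det (mat n n (\<lambda>(i, j). M i j))"
proof -
  \<comment> \<open>Matrix indices start at 0 and embeddings at 1, hence
    \<open>Suc t\<close>.\<close>
  define E where "E = mat n n (\<lambda>(i, t). \<sigma> (Suc t) (b i))"
  define P where "P = mat n n (\<lambda>(i, j). M i j)"
  define Y where "Y = mat n n (\<lambda>(i, j). if i = j then \<sigma> (Suc i) y else 0)"
  have carr: "E \<in> carrier_mat n n" "P \<in> carrier_mat n n" "Y \<in> carrier_mat n n"
    by (auto simp: E_def P_def Y_def)
  have sum_shift: "(\<Sum>t=1..n. f t) = (\<Sum>t<n. f (Suc t))" for f :: "nat \<Rightarrow> real"
    by (rule sum.reindex_bij_witness[of _ Suc "\<lambda>t. t - 1"]) auto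
  have prod_shift: "(\<Prod>t=1..n. f t) = (\<Prod>t=0..<n. f (Suc t))" for f :: "nat \<Rightarrow> real"
    by (rule prod.reindex_bij_witness[of _ Suc "\<lambda>t. t - 1"]) auto
  have lin: "\<sigma> t (\<Sum>i<n. r i * b i) = (\<Sum>i<n. r i * \<sigma> t (b i))"
    if "t \<in> {1..n}" "\<forall>i<n. r i \<in> \<rat>" for r t
  proof -
    have rK: "r i \<in> K" if "i < n" for i
      using \<open>\<forall>i<n. r i \<in> \<rat>\<close> that K_Rats by blast
    have "\<sigma> t (\<Sum>i<n. r i * b i) = (\<Sum>i<n. \<sigma> t (r i * b i))"
      by (rule \<sigma>_sum[OF that(1)]) (simp add: K_closed rK b)
    also have "\<dots> = (\<Sum>i<n. r i * \<sigma> t (b i))"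
      by (rule sum.cong) (simp_all add: \<sigma>_mult[OF that(1)] \<sigma>_Rats[OF that(1)] that(2) rK b)
    finally show ?thesis .
  qed
  have "Determinant.det E \<noteq> 0"
  proof
    assume "Determinant.det E = 0"
    then obtain v where v: "v \<in> carrier_vec n" "v \<noteq> 0\<^sub>v n" "E *\<^sub>v v = 0\<^sub>v n"
      using det_0_iff_vec_prod_zero[OF carr(1)] by auto
    have ker: "(\<Sum>t<n. \<sigma> (Suc t) (b i) * v $ t) = 0" if "i < n" for i
    proof -
      have "(E *\<^sub>v v) $ i = 0" using v that by simp
      then show ?thesis
        using that v(1) by (simp add: E_def scalar_prod_def atLeast0LessThan)
    qed
    \<comment> \<open>A kernel vector of \<open>E\<close> is a relation between the embeddings on
      all \<open>b i\<close>; as they fix \<rat>, it extends to all of \<open>K\<close>, where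
      independence applies.\<close>
    have "v $ (t - 1) = 0" if t: "t \<in> {1..n}" for t
    proof (rule \<sigma>_independent[OF _ t])
      fix x assume "x \<in> K"
      then obtain r where r: "\<forall>i<n. r i \<in> \<rat>" "x = (\<Sum>i<n. r i * b i)"
        using span by blast
      have "(\<Sum>t=1..n. v $ (t - 1) * \<sigma> t x) = (\<Sum>t<n. \<Sum>i<n. v $ t * (r i * \<sigma> (Suc t) (b i)))"
        unfolding sum_shift by (simp add: r(2) lin[OF _ r(1)] sum_distrib_left)
      also have "\<dots> = (\<Sum>i<n. r i * (\<Sum>t<n. \<sigma> (Suc t) (b i) * v $ t))"
        by (subst sum.swap) (simp add: sum_distrib_left algebra_simps)
      also have "\<dots> = 0" using ker by simp
      finally show "(\<Sum>t=1..n. v $ (t - 1) * \<sigma> t x) = 0" .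
    qed
    from this[of "Suc _"] have "v = 0\<^sub>v n"
      using v(1) by (intro eq_vecI) auto
    then show False using v(2) by simp
  qed
  moreover have "P * E = E * Y"
  proof (rule eq_matI)
    fix i t assume "i < dim_row (E * Y)" "t < dim_col (E * Y)"
    then have it: "i < n" "t < n" using carr by auto
    have "(P * E) $$ (i, t) = (\<Sum>j<n. M i j * \<sigma> (Suc t) (b j))"
      using it by (simp add: P_def E_def scalar_prod_def atLeast0LessThan)
    also have "\<dots> = \<sigma> (Suc t) (y * b i)"
      using it M by (simp add: yb lin)
    also have "\<dots> = \<sigma> (Suc t) (b i) * \<sigma> (Suc t) y"
      using it y b by (simp add: \<sigma>_mult)
    also have "\<dots> = (E * Y) $$ (i, t)"
      using it by (simp add: E_def Y_def scalar_prod_def if_distrib[of "(*) _"] cong: if_cong)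
    finally show "(P * E) $$ (i, t) = (E * Y) $$ (i, t)" .
  qed (use carr in auto)
  then have "Determinant.det P * Determinant.det E = Determinant.det E * Determinant.det Y"
    using det_mult carr by metis
  moreover have "Determinant.det Y = field_norm n \<sigma> y"
  proof -
    have "Determinant.det Y = prod_list (diag_mat Y)"
      by (rule det_upper_triangular[OF _ carr(3)]) (auto simp: Y_def)
    then show ?thesis
      unfolding field_norm_def prod_shift by (simp add: prod_list_diag_prod Y_def)
  qed
  ultimately show ?thesis by (simp add: P_def)
qed

lemma field_norm_mult:
  "x \<in> K \<Longrightarrow> y \<in> K \<Longrightarrow> field_norm n \<sigma> (x * y) = field_norm n \<sigma> x * field_norm n \<sigma> y"
  by (simp add: field_norm_def \<sigma>_mult prod.distrib)

lemma field_norm_power: "x \<in> K \<Longrightarrow> field_norm n \<sigma> (x ^ k) = field_norm n \<sigma> x ^ k"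
  by (simp add: field_norm_def \<sigma>_power prod_power_distrib)

lemma field_norm_Ints:
  assumes x: "x \<in> ring_of_integers K"
  shows "field_norm n \<sigma> x \<in> \<int>"
proof -
  have xK: "x \<in> K" and "algebraic_int x" using x by (auto simp: ring_of_integers_def)
  then obtain d where d: "\<And>k. \<exists>c::nat \<Rightarrow> int. x ^ k = (\<Sum>j<d. of_int (c j) * x ^ j)"
    using algebraic_int_power_span by blast
  obtain b where b: "\<And>i. i < n \<Longrightarrow> b i \<in> K"
    and span: "\<And>x. x \<in> K \<Longrightarrow> \<exists>r. (\<forall>i<n. r i \<in> \<rat>) \<and> x = (\<Sum>i<n. r i * b i)"
    by (rule spanning_family) blast
  have "\<exists>r. (\<forall>l<n. r l \<in> \<rat>) \<and> x ^ j * b i = (\<Sum>l<n. r l * b l)" if "i < n" for i j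
    using span b that xK by (simp add: K_closed K_power)
  then obtain R where R: "\<And>i j l. i < n \<Longrightarrow> l < n \<Longrightarrow> R i j l \<in> \<rat>"
    "\<And>i j. i < n \<Longrightarrow> x ^ j * b i = (\<Sum>l<n. R i j l * b l)"
    by metis
  \<comment> \<open>Only the powers below \<open>d\<close> contribute coordinates. Every higher
    power is an integer combination of these, so one \<open>D\<close> clears the matrices of all
    powers.\<close>
  define S where "S = (\<lambda>(i, j, l). R i j l) ` ({..<n} \<times> {..<d} \<times> {..<n})"
  have "finite S" "S \<subseteq> \<rat>" using R(1) by (auto simp: S_def)
  then obtain D :: int where D: "D \<noteq> 0" "\<forall>r\<in>S. of_int D * r \<in> \<int>"
    using common_denominator by blast
  have DR: "of_int D * R i j l \<in> \<int>" if "i < n" "j < d" "l < n" for i j l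
    using D(2) that by (force simp: S_def)
  show ?thesis
  proof (rule Ints_if_bounded_denominator)
    \<comment> \<open>Scaling an \<open>n\<close> by \<open>n\<close> matrix by \<open>D\<close>
      multiplies its determinant by \<open>D ^ n\<close>, a bound independent of
      \<open>k\<close>.\<close>
    show "D ^ n \<noteq> 0" using D by simp
    fix k
    obtain c :: "nat \<Rightarrow> int" where c: "x ^ k = (\<Sum>j<d. of_int (c j) * x ^ j)"
      using d by blast
    define M where "M i l = (\<Sum>j<d. of_int (c j) * R i j l)" for i l
    define P where "P = mat n n (\<lambda>(i, j). M i j)"
    have "x ^ k * b i = (\<Sum>l<n. M i l * b l)" if "i < n" for i
    proof -
      have "x ^ k * b i = (\<Sum>j<d. of_int (c j) * (\<Sum>l<n. R i j l * b l))"
        using R(2)[OF that, symmetric] by (simp add: c sum_distrib_right mult.assoc)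
      also have "\<dots> = (\<Sum>l<n. M i l * b l)"
        unfolding M_def sum_distrib_left sum_distrib_right by (subst sum.swap) (simp add: mult.assoc)
      finally show ?thesis .
    qed
    then have "field_norm n \<sigma> (x ^ k) = Determinant.det P"
      unfolding P_def
      by (intro field_norm_eq_det[OF b span])
         (auto simp: xK K_power M_def intro!: Rats_sum Rats_mult R(1))
    then have "of_int (D ^ n) * field_norm n \<sigma> x ^ k = Determinant.det (of_int D \<cdot>\<^sub>m P)"
      by (simp add: field_norm_power xK P_def)
    moreover have "Determinant.det (of_int D \<cdot>\<^sub>m P) \<in> \<int>"
    proof (rule Ints_det)
      fix i l assume "i < n" "l < n"
      then have "(of_int D \<cdot>\<^sub>m P) $$ (i, l) = (\<Sum>j<d. of_int (c j) * (of_int D * R i j l))"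
        by (simp add: P_def M_def sum_distrib_left algebra_simps)
      also have "\<dots> \<in> \<int>"
        by (rule Ints_sum, rule Ints_mult[OF Ints_of_int], rule DR) (use \<open>i < n\<close> \<open>l < n\<close> in auto)
      finally show "(of_int D \<cdot>\<^sub>m P) $$ (i, l) \<in> \<int>" .
    qed (simp add: P_def)
    ultimately show "of_int (D ^ n) * field_norm n \<sigma> x ^ k \<in> \<int>" by simp
  qed
qed

end

section \<open>The quaternion norm and the norm form\<close>

lemma qnorm_eq: "qnorm L = (qRe L)\<^sup>2 + (qI L)\<^sup>2 + (qJ L)\<^sup>2 + (qK L)\<^sup>2"
  by (simp add: qnorm_def qcnj_def times_quat_def power2_eq_square)

lemma qnorm_mult: "qnorm (L * M) = qnorm L * qnorm M"
  by (simp add: qnorm_eq times_quat_def power2_eq_square algebra_simps)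

lemma qnorm_eq_0_iff: "qnorm L = 0 \<longleftrightarrow> L = 0"
proof
  assume "qnorm L = 0"
  then have "(qRe L)\<^sup>2 = 0" "(qI L)\<^sup>2 = 0" "(qJ L)\<^sup>2 = 0" "(qK L)\<^sup>2 = 0"
    using zero_le_power2[of "qRe L"] zero_le_power2[of "qI L"] zero_le_power2[of "qJ L"]
      zero_le_power2[of "qK L"] unfolding qnorm_eq by linarith+
  then show "L = 0" by (simp add: quat_eq_iff zero_quat_def)
qed (simp add: qnorm_eq zero_quat_def)

lemma qcnj_mult_self: "qcnj L * L = of_real (qnorm L)"
  by (simp add: qnorm_eq qcnj_def of_real_def times_quat_def scaleR_quat_def one_quat_def
      power2_eq_square)

lemma no_zero_divisors_quat: "L * M = (0 :: quat) \<Longrightarrow> L = 0 \<or> M = 0"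
  by (metis mult_eq_0_iff qnorm_eq_0_iff qnorm_mult)

text \<open>The norm of \<open>x + y\<alpha> + z\<beta> + w\<alpha>\<beta>\<close>. As a polynomial
  in parameters and coordinates alike, it can be evaluated at their conjugates.\<close>

definition quat_form :: "real \<Rightarrow> real \<Rightarrow> real \<Rightarrow> real \<Rightarrow> real \<Rightarrow> real \<Rightarrow> real \<Rightarrow> real \<Rightarrow> real" where
  "quat_form A B \<mu> \<nu> x y z w =
     x * x + \<mu> * x * y + A * y * y + B * (z * z + \<mu> * z * w + A * w * w) + \<nu> * (y * z - x * w)"

text \<open>Completing squares: up to the factor \<open>4 * S\<close>, the form is the sum of the
  squares of the four real quaternion coordinates, each scaled by \<open>2 * sqrt S\<close>.\<close>

lemma quat_form_nonneg:
  assumes S: "disc_S A \<mu> > 0" and T: "disc_T A B \<mu> \<nu> > 0"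
  shows "quat_form A B \<mu> \<nu> x y z w \<ge> 0"
proof -
  define S T where "S = disc_S A \<mu>" and "T = disc_T A B \<mu> \<nu>"
  have "4 * S * quat_form A B \<mu> \<nu> x y z w =
     S * (2 * x + y * \<mu> - w * \<nu>)\<^sup>2 + (y * S + 2 * z * \<nu> + w * \<mu> * \<nu>)\<^sup>2
     + T * (2 * z + w * \<mu>)\<^sup>2 + S * T * w\<^sup>2"
    unfolding S_def T_def disc_S_def disc_T_def quat_form_def
    by (simp add: power2_eq_square algebra_simps)
  also have "\<dots> \<ge> 0"
    using S T by (simp add: S_def T_def)
  finally show ?thesis
    using S by (simp add: S_def zero_le_mult_iff)
qed

section \<open>Prime factors of denominators\<close>

text \<open>Strip prime factors off \<open>d\<close> until membership is lost.\<close>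

lemma prime_denominator:
  fixes R :: "real set" and H :: "'a::real_vector set"
  assumes fact: "factorial_domain (subring_of R)"
    and closed: "\<And>u L. u \<in> R \<Longrightarrow> L \<in> H \<Longrightarrow> u *\<^sub>R L \<in> H"
    and d: "d \<in> R" "d \<noteq> 0" "d *\<^sub>R Y \<in> H" and Y: "Y \<notin> H"
  obtains \<rho> d' where "\<rho> \<in> R" "ring_prime\<^bsub>subring_of R\<^esub> \<rho>" "d' \<in> R"
    "(\<rho> * d') *\<^sub>R Y \<in> H" "d' *\<^sub>R Y \<notin> H"
proof -
  interpret factorial_domain "subring_of R" by fact
  have mulR: "x * y \<in> R" if "x \<in> R" "y \<in> R" for x y
    using m_closed[of x y] that by simp
  have oneR: "1 \<in> R"
    using one_closed by simp
  have dc: "d \<in> carrier (mult_of (subring_of R))"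
    using d by simp
  \<comment> \<open>Factorizations exist for nonunits; an inverse of \<open>d\<close> would bring
    \<open>Y\<close> itself into \<open>H\<close>.\<close>
  have "d \<notin> Units (mult_of (subring_of R))"
  proof
    assume "d \<in> Units (mult_of (subring_of R))"
    then obtain e where e: "e \<in> R" "e * d = 1"
      by (auto simp: Units_def)
    then show False
      using closed[OF e(1) d(3)] Y by simp
  qed
  then obtain fs where fs: "set fs \<subseteq> carrier (mult_of (subring_of R))"
    "factors (mult_of (subring_of R)) fs d"
    using factorial_monoid.factors_exist[OF factorial_monoid_axioms dc] by blast
  have primes: "ring_prime\<^bsub>subring_of R\<^esub> p" if "p \<in> set fs" for p
  proof (rule ring_primeI')
    show "p \<in> carrier (subring_of R) - {\<zero>\<^bsub>subring_of R\<^esub>}"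
      using fs(1) that by auto
    show "Divisibility.prime (mult_of (subring_of R)) p"
      using factorial_monoid.irreducible_prime[OF factorial_monoid_axioms] fs that
      unfolding factors_def by blast
  qed
  have mul: "monoid.mult (mult_of (subring_of R)) = ((*) :: real \<Rightarrow> real \<Rightarrow> real)"
    by (simp add: fun_eq_iff)
  have "foldr (*) fs 1 = d"
    using fs(2) unfolding factors_def mul by simp
  then have "foldr (*) fs 1 *\<^sub>R Y \<in> H"
    using d(3) by simp
  moreover have "set fs \<subseteq> R"
    using fs(1) by auto
  ultimately have "\<exists>\<rho> d'. \<rho> \<in> R \<and> ring_prime\<^bsub>subring_of R\<^esub> \<rho> \<and> d' \<in> R \<and>
      (\<rho> * d') *\<^sub>R Y \<in> H \<and> d' *\<^sub>R Y \<notin> H"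
    using primes
  proof (induction fs)
    case Nil
    then show ?case using Y by simp
  next
    case (Cons p fs)
    have "foldr (*) fs 1 \<in> R"
      using Cons.prems(2) by (induction fs) (auto simp: mulR oneR)
    \<comment> \<open>If the product of the remaining factors still sends \<open>Y\<close> into
      \<open>H\<close>, the induction continues with it; otherwise \<open>p\<close> is the prime
      sought and that product is \<open>d'\<close>. The empty product 1 cannot send \<open>Y\<close>
      into \<open>H\<close>.\<close>
    then show ?case
      using Cons by (cases "foldr (*) fs 1 *\<^sub>R Y \<in> H") auto
  qed
  then show thesis using that by blast
qed

section \<open>The order in coordinates\<close>

text \<open>Only the ring axioms of the integers are assumed here; unique factorization enters with
  the principal ideal argument.\<close>

locale quaternion_order = number_field_embeddings +
  fixes A B \<mu> \<nu> :: real
  assumes id: "\<forall>x\<in>K. \<sigma> 1 x = x"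
    and R_ring: "ring (subring_of (ring_of_integers K))"
    and params: "A \<in> ring_of_integers K" "B \<in> ring_of_integers K"
      "\<mu> \<in> ring_of_integers K" "\<nu> \<in> ring_of_integers K"
    and posS: "totally_positive n \<sigma> (disc_S A \<mu>)"
    and posT: "totally_positive n \<sigma> (disc_T A B \<mu> \<nu>)"
begin

abbreviation "R \<equiv> ring_of_integers K"
abbreviation "H \<equiv> quat_order K A B \<mu> \<nu>"
abbreviation "\<alpha> \<equiv> quat_alpha A \<mu>"
abbreviation "\<beta> \<equiv> quat_beta A B \<mu> \<nu>"

definition elt :: "real \<Rightarrow> real \<Rightarrow> real \<Rightarrow> real \<Rightarrow> quat" where
  "elt x y z w = of_real x + y *\<^sub>R \<alpha> + z *\<^sub>R \<beta> + w *\<^sub>R (\<alpha> * \<beta>)"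

lemma R_closed:
  "0 \<in> R" "1 \<in> R" "x \<in> R \<Longrightarrow> y \<in> R \<Longrightarrow> x + y \<in> R" "x \<in> R \<Longrightarrow> y \<in> R \<Longrightarrow> x * y \<in> R"
  "x \<in> R \<Longrightarrow> - x \<in> R" "x \<in> R \<Longrightarrow> y \<in> R \<Longrightarrow> x - y \<in> R"
proof -
  interpret ring "subring_of R" by (rule R_ring)
  show "0 \<in> R" "1 \<in> R" "x \<in> R \<Longrightarrow> y \<in> R \<Longrightarrow> x + y \<in> R" "x \<in> R \<Longrightarrow> y \<in> R \<Longrightarrow> x * y \<in> R"
    using zero_closed one_closed a_closed[of x y] m_closed[of x y] by simp_all
  then show "x \<in> R \<Longrightarrow> - x \<in> R" for x
    using uminus_mem_subring_of[OF R_ring] by blast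
  then show "x \<in> R \<Longrightarrow> y \<in> R \<Longrightarrow> x - y \<in> R"
    using a_closed[of x "- y"] by simp
qed

lemma R_subset: "x \<in> R \<Longrightarrow> x \<in> K"
  by (simp add: ring_of_integers_def)

text \<open>An empty family spans only 0. With index 1 in range, \<open>id\<close> turns total
  positivity into positivity of the real numbers S and T.\<close>

lemma n_pos: "1 \<in> {1..n}"
proof (rule ccontr)
  assume "1 \<notin> {1..n}"
  then have "n = 0" by simp
  then show False
    using spanning_family K_closed(2) by (metis lessThan_0 sum.empty zero_neq_one)
qed

lemma disc_in_K: "disc_S A \<mu> \<in> K" "disc_T A B \<mu> \<nu> \<in> K"
  using params R_subset K_Ints[of 4]
  by (auto simp: disc_S_def disc_T_def power2_eq_square intro!: K_closed K_diff)

lemma disc_pos: "disc_S A \<mu> > 0" "disc_T A B \<mu> \<nu> > 0"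
  using posS posT n_pos id disc_in_K unfolding totally_positive_def by metis+

text \<open>Here \<open>m = \<mu>/2\<close>, \<open>s = \<surd>S/2\<close>, \<open>p = \<nu>/\<surd>S\<close> and \<open>q = \<surd>T/\<surd>S\<close>: in these parameters all structure
  constants are polynomials.\<close>

lemma coordinates:
  obtains m s p q where "\<mu> = 2 * m" "\<nu> = 2 * s * p" "A = s * s + m * m" "B = p * p + q * q"
    "\<alpha> = Quat m s 0 0" "\<beta> = Quat 0 p q 0"
    "\<And>x y z w. elt x y z w = Quat (x + y * m - w * s * p)
       (y * s + z * p + w * m * p) (z * q + w * m * q) (w * s * q)"
proof -
  define m s p q where "m = \<mu> / 2" and "s = sqrt (disc_S A \<mu>) / 2"
    and "p = \<nu> / (2 * s)" and "q = sqrt (disc_T A B \<mu> \<nu>) / (2 * s)"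
  have s: "s \<noteq> 0" "s * s = disc_S A \<mu> / 4"
    using disc_pos by (simp_all add: s_def)
  have pq: "p * (2 * s) = \<nu>" "q * (2 * s) = sqrt (disc_T A B \<mu> \<nu>)"
    using s(1) by (simp_all add: p_def q_def)
  have \<alpha>: "\<alpha> = Quat m s 0 0"
    by (simp add: quat_alpha_def quat_i_def of_real_def scaleR_quat_def plus_quat_def one_quat_def
        m_def s_def)
  have \<beta>: "\<beta> = Quat 0 p q 0"
    by (simp add: quat_beta_def quat_i_def quat_j_def scaleR_quat_def plus_quat_def
        p_def q_def s_def inverse_eq_divide)
  show thesis
  proof
    show "\<mu> = 2 * m" by (simp add: m_def)
    show "\<nu> = 2 * s * p" using pq(1) by (simp add: mult_ac)
    show "A = s * s + m * m"
      by (simp add: s(2) disc_S_def power2_eq_square m_def diff_divide_distrib)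
    have "(p * p + q * q) * (4 * (s * s)) = (p * (2 * s))\<^sup>2 + (q * (2 * s))\<^sup>2"
      by (simp add: algebra_simps power2_eq_square)
    also have "\<dots> = \<nu>\<^sup>2 + disc_T A B \<mu> \<nu>"
      unfolding pq using disc_pos(2) by simp
    also have "\<dots> = B * (4 * (s * s))"
      by (simp add: s(2) disc_T_def)
    finally show "B = p * p + q * q" using s(1) by simp
    show "elt x y z w = Quat (x + y * m - w * s * p)
       (y * s + z * p + w * m * p) (z * q + w * m * q) (w * s * q)" for x y z w
      unfolding elt_def \<alpha> \<beta>
      by (simp add: of_real_def scaleR_quat_def plus_quat_def one_quat_def times_quat_def)
  qed (fact \<alpha> \<beta>)+
qed

text \<open>This is the relation \<open>\<alpha>\<alpha> = \<mu>\<alpha> - A\<close> applied to each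
  coordinate.\<close>

lemma alpha_elt: "\<alpha> * elt x y z w = elt (- (A * y)) (x + \<mu> * y) (- (A * w)) (z + \<mu> * w)"
proof (rule coordinates)
  fix m s p q
  assume c: "\<mu> = 2 * m" "A = s * s + m * m" "\<alpha> = Quat m s 0 0"
    "\<And>x y z w. elt x y z w = Quat (x + y * m - w * s * p)
       (y * s + z * p + w * m * p) (z * q + w * m * q) (w * s * q)"
  show ?thesis
    unfolding c(3,4) unfolding c(1,2) by (simp add: times_quat_def algebra_simps)
qed

text \<open>The underlying relations are \<open>\<beta>\<beta> = -B\<close> and
  \<open>\<beta>\<alpha> = \<mu>\<beta> - \<alpha>\<beta> - \<nu>\<close>.\<close>

lemma beta_elt:
  "\<beta> * elt x y z w = elt (- (\<nu> * y + B * z + \<mu> * B * w)) (B * w) (x + \<mu> * y - \<nu> * w) (- y)"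
proof (rule coordinates)
  fix m s p q
  assume c: "\<mu> = 2 * m" "\<nu> = 2 * s * p" "B = p * p + q * q" "\<beta> = Quat 0 p q 0"
    "\<And>x y z w. elt x y z w = Quat (x + y * m - w * s * p)
       (y * s + z * p + w * m * p) (z * q + w * m * q) (w * s * q)"
  show ?thesis
    unfolding c(4,5) unfolding c(1-3) by (simp add: times_quat_def algebra_simps)
qed

lemma qnorm_elt: "qnorm (elt x y z w) = quat_form A B \<mu> \<nu> x y z w"
proof (rule coordinates)
  fix m s p q
  assume c: "\<mu> = 2 * m" "\<nu> = 2 * s * p" "A = s * s + m * m" "B = p * p + q * q"
    "\<And>x y z w. elt x y z w = Quat (x + y * m - w * s * p)
       (y * s + z * p + w * m * p) (z * q + w * m * q) (w * s * q)"
  show ?thesis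
    unfolding c(5) quat_form_def qnorm_eq unfolding c(1-4)
    by (simp add: algebra_simps power2_eq_square)
qed

text \<open>The conjugate is the trace minus the element, and \<alpha>, \<beta>, \<alpha>\<beta>
  have traces \<mu>, 0, -\<nu>.\<close>

lemma qcnj_elt: "qcnj (elt x y z w) = elt (x + \<mu> * y - \<nu> * w) (- y) (- z) (- w)"
proof (rule coordinates)
  fix m s p q
  assume c: "\<mu> = 2 * m" "\<nu> = 2 * s * p"
    "\<And>x y z w. elt x y z w = Quat (x + y * m - w * s * p)
       (y * s + z * p + w * m * p) (z * q + w * m * q) (w * s * q)"
  show ?thesis
    unfolding c(3) qcnj_def unfolding c(1,2) by (simp add: algebra_simps)
qed

lemma elt_add: "elt x y z w + elt x' y' z' w' = elt (x + x') (y + y') (z + z') (w + w')"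
  by (simp add: elt_def scaleR_add_left)

lemma scaleR_elt: "u *\<^sub>R elt x y z w = elt (u * x) (u * y) (u * z) (u * w)"
  by (simp add: elt_def scaleR_add_right of_real_def)

lemma H_iff: "L \<in> H \<longleftrightarrow> (\<exists>x\<in>R. \<exists>y\<in>R. \<exists>z\<in>R. \<exists>w\<in>R. L = elt x y z w)"
  by (auto simp: quat_order_def elt_def)

lemma H_elt: "x \<in> R \<Longrightarrow> y \<in> R \<Longrightarrow> z \<in> R \<Longrightarrow> w \<in> R \<Longrightarrow> elt x y z w \<in> H"
  by (auto simp: H_iff)

lemma H_add: "L \<in> H \<Longrightarrow> M \<in> H \<Longrightarrow> L + M \<in> H"
  by (auto simp: H_iff[of L] H_iff[of M] elt_add intro!: H_elt R_closed)

lemma H_scaleR: "u \<in> R \<Longrightarrow> L \<in> H \<Longrightarrow> u *\<^sub>R L \<in> H"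
  by (auto simp: H_iff[of L] scaleR_elt intro!: H_elt R_closed)

lemma H_uminus: "L \<in> H \<Longrightarrow> - L \<in> H"
  using H_scaleR[of "- 1" L] R_closed by simp

lemma H_zero: "0 \<in> H"
  using H_elt[of 0 0 0 0] R_closed by (simp add: elt_def)

lemma H_one: "1 \<in> H"
  using H_elt[of 1 0 0 0] R_closed by (simp add: elt_def)

lemma H_mult: assumes "L \<in> H" "M \<in> H" shows "L * M \<in> H"
proof -
  have alpha: "\<alpha> * M \<in> H" if "M \<in> H" for M
    using that params by (auto simp: H_iff[of M] alpha_elt intro!: H_elt R_closed)
  have beta: "\<beta> * M \<in> H" if "M \<in> H" for M
    using that params by (auto simp: H_iff[of M] beta_elt intro!: H_elt R_closed)
  obtain x y z w where L: "x \<in> R" "y \<in> R" "z \<in> R" "w \<in> R" "L = elt x y z w"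
    using assms(1) by (auto simp: H_iff)
  \<comment> \<open>Closure under left multiplication by \<alpha> and \<beta> suffices: integer
    coefficients are real, and \<alpha>\<beta> acts by \<beta> and then \<alpha>.\<close>
  have "L * M = x *\<^sub>R M + y *\<^sub>R (\<alpha> * M) + z *\<^sub>R (\<beta> * M) + w *\<^sub>R (\<alpha> * (\<beta> * M))"
    by (simp add: L(5) elt_def distrib_right of_real_def mult.assoc)
  then show ?thesis
    using assms(2) alpha beta L by (auto intro!: H_add H_scaleR)
qed

lemma H_qcnj: "L \<in> H \<Longrightarrow> qcnj L \<in> H"
  using params by (auto simp: H_iff[of L] qcnj_elt intro!: H_elt R_closed)

lemma H_ring: "ring (subring_of H)"
  by (rule ring_subring_ofI) (auto intro: H_zero H_one H_uminus H_add H_mult)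

lemma qnorm_in_R: "L \<in> H \<Longrightarrow> qnorm L \<in> R"
  using params by (auto simp: H_iff[of L] qnorm_elt quat_form_def intro!: R_closed)

section \<open>Double norms\<close>

lemma double_norm_Ints: "L \<in> H \<Longrightarrow> double_norm n \<sigma> L \<in> \<int>"
  by (simp add: double_norm_def field_norm_Ints qnorm_in_R)

text \<open>Each conjugate of the norm is the same form at conjugate arguments, nonnegative by total
  positivity of S and T, and nonzero because embeddings are injective.\<close>

lemma double_norm_pos: assumes "L \<in> H" "L \<noteq> 0" shows "double_norm n \<sigma> L > 0"
  unfolding double_norm_def field_norm_def
proof (rule prod_pos)
  fix i assume i: "i \<in> {1..n}"
  obtain x y z w where L: "x \<in> R" "y \<in> R" "z \<in> R" "w \<in> R" "L = elt x y z w"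
    using assms(1) by (auto simp: H_iff)
  note mem = L(1-4)[THEN R_subset] params[THEN R_subset]
  note hom = \<sigma>_add[OF i] \<sigma>_mult[OF i] \<sigma>_diff[OF i] K_closed(3,4) K_diff
  have 4: "\<sigma> i 4 = 4" "4 \<in> K"
    using \<sigma>_of_int[OF i, of 4] K_Ints[of 4] by simp_all
  have S: "\<sigma> i (disc_S A \<mu>) = disc_S (\<sigma> i A) (\<sigma> i \<mu>)"
    by (simp add: disc_S_def power2_eq_square hom mem 4)
  have T: "\<sigma> i (disc_T A B \<mu> \<nu>) = disc_T (\<sigma> i A) (\<sigma> i B) (\<sigma> i \<mu>) (\<sigma> i \<nu>)"
    by (simp add: disc_T_def power2_eq_square hom mem disc_in_K S)
  have "\<sigma> i (qnorm L) = quat_form (\<sigma> i A) (\<sigma> i B) (\<sigma> i \<mu>) (\<sigma> i \<nu>) (\<sigma> i x) (\<sigma> i y) (\<sigma> i z) (\<sigma> i w)"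
    by (simp add: L(5) qnorm_elt quat_form_def hom mem)
  then have "\<sigma> i (qnorm L) \<ge> 0"
    using quat_form_nonneg posS posT i S T unfolding totally_positive_def by metis
  moreover have "\<sigma> i (qnorm L) \<noteq> 0"
    using \<sigma>_eq_0_iff[OF i R_subset[OF qnorm_in_R[OF assms(1)]]] assms(2) by (simp add: qnorm_eq_0_iff)
  ultimately show "\<sigma> i (qnorm L) > 0" by simp
qed

text \<open>Membership of the norms in \<open>K\<close> replaces membership in \<open>H\<close>,
  since the factor \<open>L\<close> in the descent below need not lie in \<open>H\<close>.\<close>

lemma double_norm_mult:
  "qnorm L \<in> K \<Longrightarrow> qnorm M \<in> K \<Longrightarrow>
    double_norm n \<sigma> (L * M) = double_norm n \<sigma> L * double_norm n \<sigma> M"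
  by (simp add: double_norm_def qnorm_mult field_norm_mult)

section \<open>Generators of left ideals\<close>

lemma principal_if_primes_suitable:
  assumes fact: "factorial_domain (subring_of R)"
    and suit: "\<And>\<rho>. \<rho> \<in> R \<Longrightarrow> ring_prime\<^bsub>subring_of R\<^esub> \<rho> \<Longrightarrow> suitable n \<sigma> H \<rho>"
    and I: "left_ideal I (subring_of H)"
  shows "\<exists>D\<in>H. I = PIdl\<^bsub>subring_of H\<^esub> D"
proof -
  interpret I: additive_subgroup I "subring_of H"
    using I by (simp add: left_ideal_def)
  have IH: "I \<subseteq> H" and I0: "0 \<in> I" and Iadd: "\<And>x y. x \<in> I \<Longrightarrow> y \<in> I \<Longrightarrow> x + y \<in> I"
    using I.a_subset I.zero_closed I.a_closed by simp_all
  have Imult: "a * x \<in> I" if "a \<in> H" "x \<in> I" for a x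
    using I that by (simp add: left_ideal_def)
  have PIdl: "PIdl\<^bsub>subring_of H\<^esub> D = {x * D | x. x \<in> H}" for D
    by (simp add: cgenideal_def)
  show ?thesis
  proof (cases "I = {0}")
    case True
    then show ?thesis using H_zero by (intro bexI[of _ 0]) (auto simp: PIdl)
  next
    case False
    then obtain D0 where "D0 \<in> I \<and> D0 \<noteq> 0" using I0 by blast
    \<comment> \<open>Double norms of nonzero elements of \<open>I\<close> are positive integers, so
      passing to \<open>nat\<close> loses nothing and gives access to well-ordering.\<close>
    from ex_has_least_nat[where P = "\<lambda>L. L \<in> I \<and> L \<noteq> 0" and m = "\<lambda>L. nat \<lfloor>double_norm n \<sigma> L\<rfloor>", OF this]
    obtain D where D: "D \<in> I" "D \<noteq> 0"
      and least: "\<And>L. L \<in> I \<Longrightarrow> L \<noteq> 0 \<Longrightarrow> nat \<lfloor>double_norm n \<sigma> D\<rfloor> \<le> nat \<lfloor>double_norm n \<sigma> L\<rfloor>"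
      by blast
    have DH: "D \<in> H" using D IH by blast
    have min: "double_norm n \<sigma> D \<le> double_norm n \<sigma> L" if "L \<in> I" "L \<noteq> 0" for L
    proof -
      have LH: "L \<in> H" using that IH by blast
      obtain a b :: int where "double_norm n \<sigma> D = of_int a" "double_norm n \<sigma> L = of_int b"
        using double_norm_Ints[OF DH] double_norm_Ints[OF LH] by (auto elim!: Ints_cases)
      then show ?thesis
        using least[OF that] double_norm_pos[OF LH that(2)] by simp
    qed
    have q: "qnorm D \<in> R" "qnorm D \<noteq> 0"
      using qnorm_in_R[OF DH] D by (simp_all add: qnorm_eq_0_iff)
    have "M \<in> {x * D | x. x \<in> H}" if M: "M \<in> I" for M
    proof -
      \<comment> \<open>The inverse of \<open>D\<close> is its conjugate over its norm, so this is
        the right quotient of \<open>M\<close> by \<open>D\<close>.\<close>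
      define Y where "Y = (M * qcnj D) /\<^sub>R qnorm D"
      have YD: "Y * D = M"
        using q by (simp add: Y_def mult.assoc qcnj_mult_self of_real_def)
      have "Y \<in> H"
      proof (rule ccontr)
        assume "Y \<notin> H"
        moreover have "qnorm D *\<^sub>R Y \<in> H"
          using q M IH DH by (auto simp: Y_def intro!: H_mult H_qcnj)
        ultimately obtain \<rho> d where \<rho>: "\<rho> \<in> R" "ring_prime\<^bsub>subring_of R\<^esub> \<rho>" and d: "d \<in> R"
          and in_H: "(\<rho> * d) *\<^sub>R Y \<in> H" and notin_H: "d *\<^sub>R Y \<notin> H"
          using prime_denominator[OF fact H_scaleR q] by blast
        have "\<rho> \<noteq> 0" using \<rho>(2) by (simp add: ring_prime_def)
        then have div: "((\<rho> * d) *\<^sub>R Y) /\<^sub>R \<rho> = d *\<^sub>R Y" by simp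
        \<comment> \<open>Suitability is applied to \<open>(\<rho> * d) *\<^sub>R Y\<close>, whose
          quotient by \<rho> is \<open>d *\<^sub>R Y\<close>; divisibility by \<rho> would put that
          quotient into \<open>H\<close>.\<close>
        have "(\<rho> * d) *\<^sub>R Y \<notin> {\<rho> *\<^sub>R M | M. M \<in> H}"
          using notin_H \<open>\<rho> \<noteq> 0\<close> by (auto simp flip: scaleR_scaleR)
        then obtain P Q where PQ: "P \<in> H" "Q \<in> H" "P * (d *\<^sub>R Y) + Q \<noteq> 0"
          "double_norm n \<sigma> (P * (d *\<^sub>R Y) + Q) < 1"
          using suit[OF \<rho>, unfolded suitable_def, rule_format, OF in_H] unfolding div by blast
        define L where "L = P * (d *\<^sub>R Y) + Q"
        \<comment> \<open>Right multiplication by \<open>D\<close> turns \<open>Y\<close> into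
          \<open>M\<close>, leaving a left combination of elements of \<open>I\<close>.\<close>
        have LD: "L * D = P * (d *\<^sub>R M) + Q * D"
          by (simp add: L_def distrib_right mult.assoc YD)
        have "d *\<^sub>R M \<in> I"
          using Imult[OF H_scaleR[OF d H_one] M] by simp
        then have LDI: "L * D \<in> I"
          unfolding LD by (intro Iadd Imult PQ(1,2) D(1))
        have LD0: "L * D \<noteq> 0"
          using no_zero_divisors_quat[of L D] PQ(3) D(2) by (auto simp: L_def)
        \<comment> \<open>The norm of \<open>L\<close> is reached as a quotient of norms of two
          elements of \<open>H\<close>, hence lies in \<open>K\<close>.\<close>
        have "qnorm L = qnorm (L * D) * inverse (qnorm D)"
          using q by (simp add: qnorm_mult)
        also have "\<dots> \<in> K"
          using LDI IH q by (intro K_closed(4) K_inverse) (auto intro!: R_subset qnorm_in_R)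
        finally have "double_norm n \<sigma> (L * D) = double_norm n \<sigma> L * double_norm n \<sigma> D"
          using q by (simp add: double_norm_mult R_subset)
        also have "\<dots> < double_norm n \<sigma> D"
          using PQ(4) double_norm_pos[OF DH D(2)] by (simp add: L_def)
        finally show False
          using min[OF LDI LD0] by simp
      qed
      then show ?thesis using YD by blast
    qed
    moreover have "{x * D | x. x \<in> H} \<subseteq> I"
      using Imult D by blast
    ultimately show ?thesis
      using DH unfolding PIdl by (intro bexI[of _ D]) blast+
  qed
qed

end

theorem theorem5p1:
  fixes K :: "real set" and n :: nat and \<sigma> :: "nat \<Rightarrow> real \<Rightarrow> real"
    and A B \<mu> \<nu> :: real
  assumes "number_field n K" and "totally_real K"
    and "bij_betw \<sigma> {1..n} (real_embeddings K)"
    and "\<forall>x\<in>K. \<sigma> 1 x = x"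
    and "factorial_domain (subring_of (ring_of_integers K))"
    and "A \<in> ring_of_integers K" and "B \<in> ring_of_integers K"
    and "\<mu> \<in> ring_of_integers K" and "\<nu> \<in> ring_of_integers K"
    and "totally_positive n \<sigma> (disc_S A \<mu>)"
    and "totally_positive n \<sigma> (disc_T A B \<mu> \<nu>)"
    and "\<forall>\<rho>\<in>ring_of_integers K. ring_prime\<^bsub>subring_of (ring_of_integers K)\<^esub> \<rho> \<longrightarrow>
           suitable n \<sigma> (quat_order K A B \<mu> \<nu>) \<rho>"
  shows "left_principal_ideal_domain (subring_of (quat_order K A B \<mu> \<nu>))"
proof -
  interpret F: factorial_domain "subring_of (ring_of_integers K)" by fact
  interpret quaternion_order K n \<sigma> A B \<mu> \<nu>
    by unfold_locales (fact assms F.ring_axioms)+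
  show ?thesis
    unfolding left_principal_ideal_domain_def
    using H_ring no_zero_divisors_quat principal_if_primes_suitable[OF assms(5)] assms(12) by simp
qed

end
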